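(* Let $(X,\nu)$ be a Menger's 2-probabilistic normed space. Then every closed convex subset of $X$ is convex series closed.
   Context: A distribution function is a nondecreasing function $F:[-\infty,+\infty]\to[0,1]$ that is left-continuous on $\mathbb{R}$ with $F(-\infty)=0$, $F(+\infty)=1$. $\mathcal{D}$ denotes the set of proper distribution functions, i.e. those with $\lim_{x\to-\infty}F(x)=0$ and $\lim_{x\to+\infty}F(x)=1$. A Menger's 2-probabilistic normed space (Menger's 2-PN space) is a pair $(X,\nu)$ where $X$ is a real vector space with $\dim X>1$ and $\nu:X\times X\to\mathcal{D}$, $(x,y)\mapsto\nu_{x,y}$, satisfies: (A1) $\nu_{x,y}(0)=0$ for all $x,y\in X$; (A2) $\nu_{x,y}(t)=1$ for all $t>0$ if and only if $x,y$ are linearly dependent; (A3) $\nu_{x,y}(t)=\nu_{y,x}(t)$ for all $x,y\in X$, $t\in\mathbb{R}$; (A4) $\nu_{\alpha x,y}(t)=\nu_{x,y}(t/|\alpha|)$ for all $\alpha\in\mathbb{R}\setminus\{0\}$, $x,y\in X$, $t\in\mathbb{R}$; (A5) $\nu_{x+y,z}(s+t)\ge\min\{\nu_{x,z}(s),\nu_{y,z}(t)\}$ for all $x,y,z\in X$, $s,t\in\mathbb{R}$. A sequence $(x_n)$ in $X$ converges to $x\in X$ if $\lim_{n\to\infty}\nu_{x_n-x,z}(t)=1$ for all $z\in X$ and $t>0$. A series converges to its sum $x$ if its sequence of partial sums converges to $x$. The closure of $E\subseteq X$ is $\overline{E}=\{x\in X:\exists (x_n)\subset E,\ x_n\to x\}$,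 and $E$ is closed if $E=\overline{E}$. $E$ is convex if $\lambda x+(1-\lambda)y\in E$ for all $x,y\in E$, $0<\lambda<1$. A convex series of elements of $F\subseteq X$ is a series $\sum_{n=1}^\infty\lambda_nx_n$ with $x_n\in F$, $\lambda_n\ge0$ for each $n$ and $\sum_{n=1}^\infty\lambda_n=1$. $F$ is convex series closed if $F$ contains the sum of every convergent convex series of its elements. *)

theory Defs
  imports "HOL-Analysis.Analysis"
begin

definition distribution_function :: "(ereal \<Rightarrow> real) \<Rightarrow> bool" where
  "distribution_function F \<longleftrightarrow>
     mono F \<and> (\<forall>t. F t \<in> {0..1}) \<and>
     (\<forall>t::real. continuous (at_left t) (\<lambda>s. F (ereal s))) \<and>
     F (-\<infinity>) = 0 \<and> F \<infinity> = 1"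

definition proper_distribution_functions :: "(ereal \<Rightarrow> real) set" where
  "proper_distribution_functions =
     {F. distribution_function F \<and>
         ((\<lambda>t. F (ereal t)) \<longlongrightarrow> 0) at_bot \<and> ((\<lambda>t. F (ereal t)) \<longlongrightarrow> 1) at_top}"

(* Linear dependence of x, y as a family: x, x is always dependent, whereas the
   library's dependent {x, x} collapses to dependent {x} and fails for nonzero x. *)
definition linearly_dependent_pair :: "'a::real_vector \<Rightarrow> 'a \<Rightarrow> bool" where
  "linearly_dependent_pair x y \<longleftrightarrow>
     (\<exists>a b::real. (a \<noteq> 0 \<or> b \<noteq> 0) \<and> a *\<^sub>R x + b *\<^sub>R y = 0)"

(* The vector space X is the whole type. The condition dim X > 1 is stated with an
   independent set because the library's dim is 0 on infinite-dimensional spaces. *)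
locale menger_2pn_space =
  fixes \<nu> :: "'a::real_vector \<Rightarrow> 'a \<Rightarrow> ereal \<Rightarrow> real"
  assumes dim_gt_1: "\<exists>B::'a set. independent B \<and> card B > 1"
    and proper: "\<nu> x y \<in> proper_distribution_functions"
    and A1: "\<nu> x y 0 = 0"
    and A2: "(\<forall>t::real. t > 0 \<longrightarrow> \<nu> x y (ereal t) = 1) \<longleftrightarrow> linearly_dependent_pair x y"
    and A3: "\<nu> x y (ereal t) = \<nu> y x (ereal t)"
    and A4: "\<alpha> \<noteq> 0 \<Longrightarrow> \<nu> (\<alpha> *\<^sub>R x) y (ereal t) = \<nu> x y (ereal (t / \<bar>\<alpha>\<bar>))"
    and A5: "\<nu> (x + y) z (ereal (s + t)) \<ge> min (\<nu> x z (ereal s)) (\<nu> y z (ereal t))"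

definition pn_converges ::
    "('a::real_vector \<Rightarrow> 'a \<Rightarrow> ereal \<Rightarrow> real) \<Rightarrow> (nat \<Rightarrow> 'a) \<Rightarrow> 'a \<Rightarrow> bool" where
  "pn_converges \<nu> X x \<longleftrightarrow>
     (\<forall>z. \<forall>t::real. t > 0 \<longrightarrow> (\<lambda>n. \<nu> (X n - x) z (ereal t)) \<longlonglongrightarrow> 1)"

(* Series are indexed from 0, as in the library's sums. *)
definition pn_sums ::
    "('a::real_vector \<Rightarrow> 'a \<Rightarrow> ereal \<Rightarrow> real) \<Rightarrow> (nat \<Rightarrow> 'a) \<Rightarrow> 'a \<Rightarrow> bool" where
  "pn_sums \<nu> X x \<longleftrightarrow> pn_converges \<nu> (\<lambda>n. \<Sum>i<n. X i) x"

definition pn_closure ::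
    "('a::real_vector \<Rightarrow> 'a \<Rightarrow> ereal \<Rightarrow> real) \<Rightarrow> 'a set \<Rightarrow> 'a set" where
  "pn_closure \<nu> E = {x. \<exists>X. (\<forall>n. X n \<in> E) \<and> pn_converges \<nu> X x}"

definition pn_closed ::
    "('a::real_vector \<Rightarrow> 'a \<Rightarrow> ereal \<Rightarrow> real) \<Rightarrow> 'a set \<Rightarrow> bool" where
  "pn_closed \<nu> E \<longleftrightarrow> E = pn_closure \<nu> E"

definition convex_series_closed ::
    "('a::real_vector \<Rightarrow> 'a \<Rightarrow> ereal \<Rightarrow> real) \<Rightarrow> 'a set \<Rightarrow> bool" where
  "convex_series_closed \<nu> F \<longleftrightarrow>
     (\<forall>(X :: nat \<Rightarrow> 'a) (c :: nat \<Rightarrow> real) x.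
        (\<forall>n. X n \<in> F) \<and> (\<forall>n. c n \<ge> 0) \<and> c sums 1 \<and>
        pn_sums \<nu> (\<lambda>n. c n *\<^sub>R X n) x \<longrightarrow> x \<in> F)"

end

(* The partial sums S_n of a convex series are completed to convex combinations
   S_n + r_n X_0, where r_n is the remaining weight. These lie in the convex set, and they
   still converge to the sum, because r_n -> 0 and the distribution function of (X_0, z) is
   proper. *)
theory Submission
  imports Defs
begin

context menger_2pn_space
begin

lemma le_1: "\<nu> x y t \<le> 1"
  using proper[of x y] by (auto simp: proper_distribution_functions_def distribution_function_def)

lemma tendsto_1_at_top: "((\<lambda>t. \<nu> x y (ereal t)) \<longlongrightarrow> 1) at_top"
  using proper[of x y] by (simp add: proper_distribution_functions_def)

lemma zero_left: "t > 0 \<Longrightarrow> \<nu> 0 z (ereal t) = 1"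
proof -
  have "linearly_dependent_pair 0 z"
    unfolding linearly_dependent_pair_def by (intro exI[of _ 1] exI[of _ 0]) simp
  then show "t > 0 \<Longrightarrow> \<nu> 0 z (ereal t) = 1"
    using A2 by blast
qed

text \<open>Values of \<open>\<nu>\<close> never exceed 1, so only lower bounds matter. This
  one-sided form suits the minimum in \<open>A5\<close>: to exceed \<open>a\<close>, it is enough
  that both arguments do.\<close>

lemma pn_converges_iff:
  "pn_converges \<nu> X x \<longleftrightarrow>
     (\<forall>z. \<forall>t::real>0. \<forall>a<1. \<forall>\<^sub>F n in sequentially. a < \<nu> (X n - x) z (ereal t))"
proof -
  have "\<forall>u>1. \<forall>\<^sub>F n in sequentially. \<nu> (X n - x) z (ereal t) < u" for z and t :: real
    by (auto intro!: always_eventually le_less_trans[OF le_1])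
  then show ?thesis
    by (simp add: pn_converges_def order_tendsto_iff)
qed

text \<open>\<open>A5\<close> with \<open>t\<close> split into two halves.\<close>

lemma pn_converges_add:
  assumes "pn_converges \<nu> X x" "pn_converges \<nu> Y y"
  shows "pn_converges \<nu> (\<lambda>n. X n + Y n) (x + y)"
  unfolding pn_converges_iff
proof (intro allI impI)
  fix z and t a :: real
  assume "t > 0" "a < 1"
  then have "\<forall>\<^sub>F n in sequentially. a < \<nu> (X n - x) z (ereal (t/2))"
    and "\<forall>\<^sub>F n in sequentially. a < \<nu> (Y n - y) z (ereal (t/2))"
    using assms unfolding pn_converges_iff by (meson half_gt_zero)+
  then show "\<forall>\<^sub>F n in sequentially. a < \<nu> (X n + Y n - (x + y)) z (ereal t)"
  proof eventually_elim
    case (elim n)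
    then show ?case
      using A5[where x = "X n - x" and y = "Y n - y" and z = z and s = "t/2" and t = "t/2"] by (simp add: algebra_simps)
  qed
qed

text \<open>By \<open>A4\<close> the factor \<open>r n\<close> moves into the argument as
  \<open>t / \<bar>r n\<bar>\<close>, which grows without bound as \<open>r n\<close> tends to 0,
  and a proper distribution function tends to 1 there.\<close>

lemma pn_converges_scaleR_zero:
  assumes "r \<longlonglongrightarrow> (0::real)"
  shows "pn_converges \<nu> (\<lambda>n. r n *\<^sub>R x) 0"
  unfolding pn_converges_iff
proof (intro allI impI)
  fix z and t a :: real
  assume t: "t > 0" and "a < 1"
  from tendsto_1_at_top \<open>a < 1\<close> have "\<forall>\<^sub>F s in at_top. a < \<nu> x z (ereal s)"
    by (rule order_tendstoD)
  then obtain S where S: "\<And>s. s \<ge> S \<Longrightarrow> a < \<nu> x z (ereal s)"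
    by (auto simp: eventually_at_top_linorder)
  \<comment> \<open>The product form of \<open>S \<le> t / \<bar>r n\<bar>\<close> avoids dividing
    by \<open>r n\<close>, which may vanish, and requires nothing of the sign of
    \<open>S\<close>.\<close>
  have "(\<lambda>n. \<bar>r n\<bar> * S) \<longlonglongrightarrow> \<bar>0\<bar> * S"
    by (intro tendsto_intros assms)
  then have "\<forall>\<^sub>F n in sequentially. \<bar>r n\<bar> * S < t"
    using t by (intro order_tendstoD) auto
  then show "\<forall>\<^sub>F n in sequentially. a < \<nu> (r n *\<^sub>R x - 0) z (ereal t)"
  proof eventually_elim
    case (elim n)
    show ?case
    \<comment> \<open>\<open>A4\<close> covers nonzero scalars only; for \<open>r n = 0\<close> the
      vector is 0, and \<open>A2\<close> gives the value 1.\<close>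
    proof (cases "r n = 0")
      case True
      then show ?thesis
        using t \<open>a < 1\<close> by (simp add: zero_left)
    next
      case False
      with elim have "S \<le> t / \<bar>r n\<bar>"
        by (simp add: field_simps)
      then show ?thesis
        using S False by (simp add: A4)
    qed
  qed
qed

end

lemma convex_completed_partial_sum:
  fixes X :: "nat \<Rightarrow> 'a::real_vector"
  assumes "convex E" "\<And>n. X n \<in> E" "\<And>n. c n \<ge> 0" "sum c {..<n} \<le> 1" "y \<in> E"
  shows "(\<Sum>i<n. c i *\<^sub>R X i) + (1 - sum c {..<n}) *\<^sub>R y \<in> E"
proof -
  \<comment> \<open>Index \<open>n\<close> carries the leftover weight and the point
    \<open>y\<close>, so the weights over \<open>{..<Suc n}\<close> add up to 1.\<close>
  define w where "w i = (if i < n then c i else 1 - sum c {..<n})" for i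
  define Y where "Y i = (if i < n then X i else y)" for i
  have "(\<Sum>i<Suc n. w i *\<^sub>R Y i) \<in> E"
    using assms by (intro convex_sum) (auto simp: w_def Y_def)
  then show ?thesis
    by (simp add: w_def Y_def)
qed

theorem theorem2p1:
  fixes \<nu> :: "'a::real_vector \<Rightarrow> 'a \<Rightarrow> ereal \<Rightarrow> real"
    and E :: "'a set"
  assumes "menger_2pn_space \<nu>"
    and "pn_closed \<nu> E"
    and "convex E"
  shows "convex_series_closed \<nu> E"
  unfolding convex_series_closed_def
proof (intro allI impI, elim conjE)
  interpret menger_2pn_space \<nu> by fact
  fix X :: "nat \<Rightarrow> 'a" and c :: "nat \<Rightarrow> real" and x
  assume X: "\<forall>n. X n \<in> E" and c: "\<forall>n. c n \<ge> 0" "c sums 1"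
    and x: "pn_sums \<nu> (\<lambda>n. c n *\<^sub>R X n) x"
  let ?r = "\<lambda>n. 1 - sum c {..<n}"
  \<comment> \<open>The completing point \<open>X 0\<close> is the same for all \<open>n\<close>, so
    the correction is a null sequence of scalars times one fixed vector.\<close>
  let ?Y = "\<lambda>n. (\<Sum>i<n. c i *\<^sub>R X i) + ?r n *\<^sub>R X 0"
  \<comment> \<open>Partial sums of a nonnegative series stay below its sum, so the leftover weight
    is nonnegative.\<close>
  have "sum c {..<n} \<le> 1" for n
    using c sum_le_suminf[of c "{..<n}"] by (auto simp: sums_iff)
  then have "?Y n \<in> E" for n
    using X c assms(3) by (intro convex_completed_partial_sum) auto
  moreover have "?r \<longlonglongrightarrow> 1 - 1"
    using c unfolding sums_def by (intro tendsto_intros)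
  then have "pn_converges \<nu> ?Y (x + 0)"
    using x unfolding pn_sums_def by (intro pn_converges_add pn_converges_scaleR_zero) auto
  ultimately have "x \<in> pn_closure \<nu> E"
    unfolding pn_closure_def by (auto intro!: exI[of _ ?Y])
  then show "x \<in> E"
    using assms(2) unfolding pn_closed_def by simp
qed

end
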